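(* For any cubic graph $G$ of order $n$, $$\gamma_{\mathrm{sdR}}(G)\ \ge\ \begin{cases} n/2 & \text{if } n\equiv 0 \pmod 4,\\ n/2+1 & \text{if } n\equiv 2\pmod 4.\end{cases}$$
   Context: All graphs are finite, undirected and simple; a cubic graph is a 3-regular graph (so $n$ is even). $N(u)$ is the open neighborhood of $u$, $N[u]=N(u)\cup\{u\}$. For $f:V\to\{-1,1,2,3\}$ write $V_i=f^{-1}(i)$ and $f(S)=\sum_{s\in S}f(s)$. A signed double Roman domination function (SDRDF) is $f:V\to\{-1,1,2,3\}$ such that: (1) every $u\in V_{-1}$ has a neighbor in $V_3$ or at least two distinct neighbors in $V_2$; (2) every $u\in V_1$ has a neighbor in $V_2\cup V_3$; (3) $f(N[u])\ge 1$ for all $u\in V$. $\gamma_{\mathrm{sdR}}(G)$ is the minimum of $f(V)$ over all SDRDFs on $G$. *)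

theory Defs
  imports Complex_Main "Graph_Theory.Pair_Digraph"
begin

text \<open>
  A finite undirected simple graph is a \<^locale>\<open>pair_graph\<close>: an undirected edge $uv$ is
  represented by the two arcs $(u,v)$ and $(v,u)$, so that the degree of a vertex is its
  out-degree.
\<close>

definition cubic_graph :: "'a pair_pre_digraph \<Rightarrow> bool" where
  "cubic_graph G \<longleftrightarrow> pair_graph G \<and> (\<forall>u \<in> pverts G. out_degree (with_proj G) u = 3)"

definition open_nbhd :: "'a pair_pre_digraph \<Rightarrow> 'a \<Rightarrow> 'a set" where
  "open_nbhd G u = {v \<in> pverts G. (u, v) \<in> parcs G}"

definition closed_nbhd :: "'a pair_pre_digraph \<Rightarrow> 'a \<Rightarrow> 'a set" where
  "closed_nbhd G u = insert u (open_nbhd G u)"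

text \<open>Only the values of \<open>f\<close> on the vertex set are relevant.\<close>

definition sdrdf :: "'a pair_pre_digraph \<Rightarrow> ('a \<Rightarrow> int) \<Rightarrow> bool" where
  "sdrdf G f \<longleftrightarrow>
     f \<in> pverts G \<rightarrow> {-1, 1, 2, 3} \<and>
     (\<forall>u \<in> pverts G. f u = -1 \<longrightarrow>
        (\<exists>v \<in> open_nbhd G u. f v = 3) \<or>
        (\<exists>v \<in> open_nbhd G u. \<exists>w \<in> open_nbhd G u. v \<noteq> w \<and> f v = 2 \<and> f w = 2)) \<and>
     (\<forall>u \<in> pverts G. f u = 1 \<longrightarrow> (\<exists>v \<in> open_nbhd G u. f v = 2 \<or> f v = 3)) \<and>
     (\<forall>u \<in> pverts G. sum f (closed_nbhd G u) \<ge> 1)"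

definition sdrdf_weights :: "'a pair_pre_digraph \<Rightarrow> int set" where
  "sdrdf_weights G = {sum f (pverts G) | f. sdrdf G f}"

definition gamma_sdR :: "'a pair_pre_digraph \<Rightarrow> int" where
  "gamma_sdR G = Min (sdrdf_weights G)"

lemma out_degree_eq_card_open_nbhd:
  assumes "pair_graph G"
  shows "out_degree (with_proj G) u = card (open_nbhd G u)"
proof -
  interpret pair_graph G by fact
  have "out_arcs (with_proj G) u = Pair u ` open_nbhd G u"
    by (auto simp: out_arcs_def open_nbhd_def dest: in_arcsD2)
  then show ?thesis
    by (simp add: out_degree_def card_image inj_on_def)
qed

text \<open>The minimum defining \<open>gamma_sdR\<close> is taken over a nonempty finite set.\<close>

lemma finite_sdrdf_weights:
  assumes "pair_graph G"
  shows "finite (sdrdf_weights G)"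
proof -
  interpret pair_graph G by fact
  let ?n = "int (card (pverts G))"
  have "sum f (pverts G) \<in> {- ?n .. 3 * ?n}" if "sdrdf G f" for f
  proof -
    have "- 1 \<le> f u \<and> f u \<le> 3" if "u \<in> pverts G" for u
    proof -
      have "f u \<in> {-1, 1, 2, 3}"
        using \<open>sdrdf G f\<close> that by (auto simp: sdrdf_def Pi_iff)
      then show ?thesis by auto
    qed
    then show ?thesis
      using sum_bounded_below[of "pverts G" "-1" f] sum_bounded_above[of "pverts G" f 3]
      by (auto simp: mult.commute)
  qed
  then have "sdrdf_weights G \<subseteq> {- ?n .. 3 * ?n}"
    by (auto simp: sdrdf_weights_def)
  then show ?thesis
    by (rule finite_subset) simp
qed

lemma sdrdf_weights_nonempty:
  assumes "pair_graph G"
  shows "sdrdf_weights G \<noteq> {}"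
proof -
  interpret pair_graph G by fact
  have "finite (closed_nbhd G u)" for u
    by (simp add: closed_nbhd_def open_nbhd_def)
  then have card_pos: "0 < card (closed_nbhd G u)" for u
    by (auto simp: card_gt_0_iff closed_nbhd_def)
  have "1 \<le> 2 * int (card (closed_nbhd G u))" for u
    using card_pos[of u] by linarith
  then have "sdrdf G (\<lambda>_. 2)"
    by (auto simp: sdrdf_def mult.commute)
  then show ?thesis
    by (auto simp: sdrdf_weights_def)
qed

end

theory Submission
  imports Defs
begin

text \<open>
  Discharging: give every vertex \<open>v\<close> the charge \<open>4 f v - 2\<close>, so that the total charge is
  \<open>4 f(V) - 2n\<close>. A vertex of value \<open>-1\<close> has charge \<open>-6\<close>; a vertex \<open>v\<close> of positive value has at
  most two neighbours of value \<open>-1\<close> and sends \<open>2 f v - 1\<close>, half of its charge, to each of them.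
  A vertex of value \<open>-1\<close> then receives at least \<open>6\<close>, whence \<open>f(V) \<ge> n/2\<close>. If equality holds, then
  every vertex of value \<open>-1\<close> has exactly one neighbour of value \<open>-1\<close>, so the number \<open>a\<close> of these
  vertices is even, and every other vertex has exactly two neighbours of value \<open>-1\<close>, so that
  counting edges gives \<open>a = n/2\<close>. Hence \<open>4\<close> divides \<open>n\<close>.
\<close>

text \<open>Sending each element to its partner is an involution without fixed points, so the orbits
  \<open>{u, p u}\<close> split \<open>A\<close> into disjoint pairs.\<close>

lemma even_card_if_unique_partner:
  assumes "finite A"
    and sym: "\<And>u v. u \<in> A \<Longrightarrow> v \<in> A \<Longrightarrow> R u v \<Longrightarrow> R v u"
    and irrefl: "\<And>u. u \<in> A \<Longrightarrow> \<not> R u u"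
    and partner: "\<And>u. u \<in> A \<Longrightarrow> \<exists>!v. v \<in> A \<and> R u v"
  shows "even (card A)"
proof -
  define p where "p u = (THE v. v \<in> A \<and> R u v)" for u
  have p: "p u \<in> A" "R u (p u)" if "u \<in> A" for u
    using theI'[OF partner[OF that]] by (auto simp: p_def)
  have pp: "p (p u) = u" if "u \<in> A" for u
    using partner[OF p(1)[OF that]] p[OF that] p[OF p(1)[OF that]] sym that by blast
  have p_neq: "p u \<noteq> u" if "u \<in> A" for u
    using irrefl p that by metis
  let ?C = "(\<lambda>u. {u, p u}) ` A"
  have union: "\<Union>?C = A"
    using p by auto
  have "2 * card ?C = card (\<Union>?C)"
  proof (rule card_partition)
    show "card c = 2" if "c \<in> ?C" for c
      using that p_neq by (metis (no_types, lifting) card_2_iff imageE)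
    \<comment> \<open>A pair is determined by either of its elements, so two pairs that meet
      coincide.\<close>
    have block: "c = {w, p w}" if "c \<in> ?C" "w \<in> c" for c w
    proof -
      obtain x where x: "x \<in> A" "c = {x, p x}"
        using \<open>c \<in> ?C\<close> by blast
      show ?thesis
        using \<open>w \<in> c\<close> unfolding x(2) by (elim insertE emptyE) (simp_all add: pp[OF x(1)] insert_commute)
    qed
    show "c \<inter> d = {}" if "c \<in> ?C" "d \<in> ?C" "c \<noteq> d" for c d
    proof (rule ccontr)
      assume "c \<inter> d \<noteq> {}"
      then obtain w where "w \<in> c" "w \<in> d"
        by blast
      then have "c = d"
        by (simp only: block[OF that(1) \<open>w \<in> c\<close>] block[OF that(2) \<open>w \<in> d\<close>])
      with \<open>c \<noteq> d\<close> show False ..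
    qed
  qed (use \<open>finite A\<close> union in auto)
  then show ?thesis
    using union by (metis dvd_triv_left)
qed

lemma open_nbhd_sym:
  assumes "pair_graph G" "u \<in> pverts G"
  shows "v \<in> open_nbhd G u \<Longrightarrow> u \<in> open_nbhd G v"
proof -
  interpret pair_graph G by fact
  show "v \<in> open_nbhd G u \<Longrightarrow> u \<in> open_nbhd G v"
    using assms(2) arcs_symmetric by (auto simp: open_nbhd_def)
qed

lemma not_in_open_nbhd:
  assumes "pair_graph G"
  shows "u \<notin> open_nbhd G u"
proof -
  interpret pair_graph G by fact
  show ?thesis
    using no_loops' by (auto simp: open_nbhd_def)
qed

lemma cubic_graph_open_nbhdE:
  assumes "cubic_graph G" "u \<in> pverts G"
  obtains x y z where "open_nbhd G u = {x, y, z}" "x \<noteq> y" "x \<noteq> z" "y \<noteq> z" "u \<notin> {x, y, z}"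
    "{x, y, z} \<subseteq> pverts G"
proof -
  have G: "pair_graph G" and "card (open_nbhd G u) = 3"
    using assms out_degree_eq_card_open_nbhd[of G u] by (auto simp: cubic_graph_def)
  then obtain x y z where "open_nbhd G u = {x, y, z}" "x \<noteq> y" "x \<noteq> z" "y \<noteq> z"
    unfolding card_3_iff by blast
  moreover have "open_nbhd G u \<subseteq> pverts G"
    by (auto simp: open_nbhd_def)
  ultimately show ?thesis
    using that not_in_open_nbhd[OF G, of u] by metis
qed

lemma sdrdf_values:
  assumes "sdrdf G f" "u \<in> pverts G"
  shows "f u = -1 \<or> f u = 1 \<or> f u = 2 \<or> f u = 3"
  using assms by (auto simp: sdrdf_def Pi_iff)

text \<open>Three neighbours of value -1 would give a closed neighbourhood sum of at most 3 - 3 =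
  0.\<close>

lemma sdrdf_card_minus_one_nbrs_le_2:
  assumes "cubic_graph G" "sdrdf G f" "u \<in> pverts G"
  shows "card {v \<in> open_nbhd G u. f v = -1} \<le> 2"
proof -
  obtain x y z where N: "open_nbhd G u = {x, y, z}" "x \<noteq> y" "x \<noteq> z" "y \<noteq> z" "u \<notin> {x, y, z}"
    using cubic_graph_open_nbhdE[OF assms(1,3)] by metis
  have "sum f (closed_nbhd G u) \<ge> 1"
    using assms by (auto simp: sdrdf_def)
  then have sum: "f u + f x + f y + f z \<ge> 1"
    using N by (simp add: closed_nbhd_def)
  have "\<not> (f x = -1 \<and> f y = -1 \<and> f z = -1)"
    using sum sdrdf_values[OF assms(2,3)] by linarith
  then have "{v \<in> open_nbhd G u. f v = -1} \<subset> {x, y, z}"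
    using N by auto
  then have "card {v \<in> open_nbhd G u. f v = -1} < card {x, y, z}"
    by (rule psubset_card_mono[rotated]) simp
  then show ?thesis
    using N by simp
qed

text \<open>Since \<open>f u = -1\<close>, the three neighbours sum to at least 2, so at most one of
  them has value -1. If one does, the domination condition makes the other two sum to at least 4 (as
  3 + 1 or 2 + 2), so \<open>r\<close> is at least 2 * 4 - 2 = 6. If none does, the three sum to at
  least 5 and \<open>r\<close> is at least 2 * 5 - 3 = 7, which rules out equality.\<close>

lemma sdrdf_charge_received:
  assumes "cubic_graph G" "sdrdf G f" "u \<in> pverts G" "f u = -1"
  defines "r \<equiv> (\<Sum>v | v \<in> open_nbhd G u \<and> f v \<noteq> -1. 2 * f v - 1)"
  shows "r \<ge> 6" and "r = 6 \<Longrightarrow> \<exists>!v. v \<in> open_nbhd G u \<and> f v = -1"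
proof -
  obtain x y z where N: "open_nbhd G u = {x, y, z}" "x \<noteq> y" "x \<noteq> z" "y \<noteq> z" "u \<notin> {x, y, z}"
    "{x, y, z} \<subseteq> pverts G"
    using cubic_graph_open_nbhdE[OF assms(1,3)] by metis
  have "sum f (closed_nbhd G u) \<ge> 1"
    using assms by (auto simp: sdrdf_def)
  then have sum: "f u + f x + f y + f z \<ge> 1"
    using N by (simp add: closed_nbhd_def)
  have "(\<exists>v \<in> open_nbhd G u. f v = 3) \<or>
        (\<exists>v \<in> open_nbhd G u. \<exists>w \<in> open_nbhd G u. v \<noteq> w \<and> f v = 2 \<and> f w = 2)"
    using assms by (auto simp: sdrdf_def)
  then have dom: "f x = 3 \<or> f y = 3 \<or> f z = 3 \<or> (f x = 2 \<and> f y = 2) \<or> (f x = 2 \<and> f z = 2)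
      \<or> (f y = 2 \<and> f z = 2)"
    using N by auto
  have vals: "f x = -1 \<or> f x = 1 \<or> f x = 2 \<or> f x = 3" "f y = -1 \<or> f y = 1 \<or> f y = 2 \<or> f y = 3"
    "f z = -1 \<or> f z = 1 \<or> f z = 2 \<or> f z = 3"
    using N sdrdf_values[OF assms(2)] by auto
  have "r = (\<Sum>v \<in> {x, y, z}. if f v \<noteq> -1 then 2 * f v - 1 else 0)"
    unfolding r_def N(1) by (rule sum.inter_filter) simp
  also have "\<dots> = (if f x \<noteq> -1 then 2 * f x - 1 else 0) + (if f y \<noteq> -1 then 2 * f y - 1 else 0)
      + (if f z \<noteq> -1 then 2 * f z - 1 else 0)"
    using N by simp
  finally have r: "r = \<dots>" .
  show "r \<ge> 6"
    using sum dom vals \<open>f u = -1\<close> unfolding r by (elim disjE) simp_all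
  show "\<exists>!v. v \<in> open_nbhd G u \<and> f v = -1" if "r = 6"
  proof -
    have "(f x = -1 \<and> f y \<noteq> -1 \<and> f z \<noteq> -1) \<or> (f x \<noteq> -1 \<and> f y = -1 \<and> f z \<noteq> -1)
        \<or> (f x \<noteq> -1 \<and> f y \<noteq> -1 \<and> f z = -1)"
      using that sum dom vals \<open>f u = -1\<close> unfolding r by (elim disjE) simp_all
    then show ?thesis
      unfolding N(1) by blast
  qed
qed

text \<open>Doubling keeps the bound within the integers. The tight case later yields the extra 1
  when \<open>n\<close> is 2 modulo 4.\<close>

lemma sdrdf_weight:
  assumes "cubic_graph G" "sdrdf G f"
  defines "n \<equiv> int (card (pverts G))"
  shows "n \<le> 2 * sum f (pverts G)" and "2 * sum f (pverts G) = n \<Longrightarrow> 4 dvd n"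
proof -
  have G: "pair_graph G"
    using assms by (simp add: cubic_graph_def)
  interpret pair_graph G by fact
  define A where "A = {u \<in> pverts G. f u = -1}"
  define B where "B = {u \<in> pverts G. f u \<noteq> -1}"
  have fin: "finite A" "finite B" and V: "pverts G = A \<union> B" "A \<inter> B = {}"
    by (auto simp: A_def B_def)
  have n: "n = card A + card B"
    using fin V by (simp add: n_def card_Un_disjoint)
  have fA: "sum f A = - int (card A)"
    by (simp add: A_def)
  have w: "sum f (pverts G) = sum f B - card A"
    using fin V fA by (simp add: sum.union_disjoint)
  define r where "r u = (\<Sum>v | v \<in> open_nbhd G u \<and> f v \<noteq> -1. 2 * f v - 1)" for u
  define m where "m v = card {u \<in> open_nbhd G v. f u = -1}" for v
  have nbr: "v \<in> pverts G" if "v \<in> open_nbhd G u" for u v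
    using that by (simp add: open_nbhd_def)
  \<comment> \<open>Symmetry of adjacency recasts the count in the form needed to exchange the two
    summations.\<close>
  have m_A: "m v = card {u \<in> A. v \<in> open_nbhd G u}" if "v \<in> pverts G" for v
    unfolding m_def A_def
    by (rule arg_cong[where f = card]) (use nbr open_nbhd_sym[OF G] that in blast)
  \<comment> \<open>The charge crossing the edges between \<open>A\<close> and \<open>B\<close> is
    summed first by receiver, then by sender.\<close>
  have double_count: "(\<Sum>u \<in> A. r u) = (\<Sum>v \<in> B. int (m v) * (2 * f v - 1))"
  proof -
    have "(\<Sum>u \<in> A. r u) = (\<Sum>u \<in> A. \<Sum>v | v \<in> B \<and> v \<in> open_nbhd G u. 2 * f v - 1)"
      unfolding r_def B_def by (intro sum.cong) (auto dest: nbr)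
    also have "\<dots> = (\<Sum>v \<in> B. \<Sum>u | u \<in> A \<and> v \<in> open_nbhd G u. 2 * f v - 1)"
      using fin by (rule sum.swap_restrict)
    also have "\<dots> = (\<Sum>v \<in> B. int (m v) * (2 * f v - 1))"
      using m_A by (intro sum.cong) (auto simp: B_def)
    finally show ?thesis .
  qed
  \<comment> \<open>Monotonicity applies because \<open>f v\<close> is at least 1 on
    \<open>B\<close>, so the factor is nonnegative.\<close>
  have sends: "int (m v) * (2 * f v - 1) \<le> 2 * (2 * f v - 1)" if "v \<in> B" for v
    using that sdrdf_card_minus_one_nbrs_le_2[OF assms(1,2), of v] sdrdf_values[OF assms(2), of v]
    by (intro mult_right_mono) (auto simp: B_def m_def)
  have receives: "6 \<le> r u" if "u \<in> A" for u
    using that sdrdf_charge_received(1)[OF assms(1,2), of u] by (simp add: A_def r_def)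
  have total: "(\<Sum>v \<in> B. 2 * (2 * f v - 1)) - (\<Sum>u \<in> A. 6) = 4 * sum f (pverts G) - 2 * n"
    by (simp add: w n sum_subtractf flip: sum_distrib_left)
  have ge: "(\<Sum>u \<in> A. 6) \<le> (\<Sum>u \<in> A. r u)"
    using receives by (rule sum_mono)
  have le: "(\<Sum>v \<in> B. int (m v) * (2 * f v - 1)) \<le> (\<Sum>v \<in> B. 2 * (2 * f v - 1))"
    using sends by (rule sum_mono)
  show "n \<le> 2 * sum f (pverts G)"
    using ge le double_count total by linarith
  show "4 dvd n" if tight: "2 * sum f (pverts G) = n"
  proof -
    \<comment> \<open>A total charge of 0 leaves no slack in either estimate, so both hold with
      equality, first in total and then vertex by vertex.\<close>
    have eqA: "(\<Sum>u \<in> A. 6) = (\<Sum>u \<in> A. r u)"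
      and eqB: "(\<Sum>v \<in> B. int (m v) * (2 * f v - 1)) = (\<Sum>v \<in> B. 2 * (2 * f v - 1))"
      using ge le double_count total tight by linarith+
    have rA: "\<forall>u \<in> A. r u = 6"
      using sum_mono_inv[OF eqA _ _ fin(1)] receives by metis
    have "\<forall>v \<in> B. int (m v) * (2 * f v - 1) = 2 * (2 * f v - 1)"
      using sum_mono_inv[OF eqB _ _ fin(2)] sends by blast
    \<comment> \<open>This number is odd, so it can be cancelled.\<close>
    moreover have "2 * f v - 1 \<noteq> 0" for v
      by presburger
    ultimately have mB: "\<forall>v \<in> B. m v = 2"
      by (metis mult_right_cancel of_nat_eq_iff of_nat_numeral)
    have partner: "\<exists>!v. v \<in> open_nbhd G u \<and> f v = -1" if "u \<in> A" for u
      using that rA sdrdf_charge_received(2)[OF assms(1,2), of u] by (simp add: A_def r_def)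
    have "even (card A)"
    proof (rule even_card_if_unique_partner[where R = "\<lambda>u v. v \<in> open_nbhd G u"])
      show "\<exists>!v. v \<in> A \<and> v \<in> open_nbhd G u" if "u \<in> A" for u
        using partner[OF that] nbr unfolding A_def by blast
      show "u \<in> open_nbhd G v" if "u \<in> A" "v \<in> open_nbhd G u" for u v
        by (rule open_nbhd_sym[OF G]) (use that in \<open>simp_all add: A_def\<close>)
    qed (use fin not_in_open_nbhd[OF G] in simp_all)
    \<comment> \<open>Each vertex of \<open>A\<close> has 3 - 1 = 2 neighbours in \<open>B\<close>,
      and each vertex of \<open>B\<close> has two in \<open>A\<close>; count the edges between them
      from both sides.\<close>
    moreover have "card A = card B"
    proof -
      have others: "card {v \<in> B. v \<in> open_nbhd G u} = 2" if "u \<in> A" for u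
      proof -
        have u: "u \<in> pverts G"
          using that by (simp add: A_def)
        obtain x y z where N: "open_nbhd G u = {x, y, z}" "x \<noteq> y" "x \<noteq> z" "y \<noteq> z"
          using cubic_graph_open_nbhdE[OF assms(1) u] by metis
        obtain p where p: "{v \<in> open_nbhd G u. f v = -1} = {p}"
          using partner[OF \<open>u \<in> A\<close>] by blast
        have "{v \<in> B. v \<in> open_nbhd G u} = open_nbhd G u - {p}"
          unfolding B_def p[symmetric] using nbr by blast
        moreover have "p \<in> open_nbhd G u"
          using p by blast
        ultimately show ?thesis
          using N by (simp add: card_Diff_singleton)
      qed
      have "2 * card A = (\<Sum>u \<in> A. card {v \<in> B. v \<in> open_nbhd G u})"
        using others by simp
      also have "\<dots> = (\<Sum>v \<in> B. card {u \<in> A. v \<in> open_nbhd G u})"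
        using sum.swap_restrict[OF fin, of "\<lambda>_ _. 1 :: nat" "\<lambda>u v. v \<in> open_nbhd G u"] by simp
      also have "\<dots> = 2 * card B"
        using mB m_A V by simp
      finally show ?thesis by simp
    qed
    ultimately show ?thesis
      unfolding n by (auto elim!: evenE)
  qed
qed

theorem theorem3:
  fixes G :: "'a pair_pre_digraph" and n :: nat
  assumes "cubic_graph G" and "card (pverts G) = n"
  shows "(n mod 4 = 0 \<longrightarrow> real_of_int (gamma_sdR G) \<ge> real n / 2) \<and>
         (n mod 4 = 2 \<longrightarrow> real_of_int (gamma_sdR G) \<ge> real n / 2 + 1)"
proof -
  have G: "pair_graph G"
    using assms by (simp add: cubic_graph_def)
  have "gamma_sdR G \<in> sdrdf_weights G"
    unfolding gamma_sdR_def
    by (intro Min_in finite_sdrdf_weights sdrdf_weights_nonempty G)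
  then obtain f where "sdrdf G f" and f: "gamma_sdR G = sum f (pverts G)"
    by (auto simp: sdrdf_weights_def)
  then have bound: "int n \<le> 2 * gamma_sdR G" and eq: "2 * gamma_sdR G = int n \<Longrightarrow> 4 dvd int n"
    using sdrdf_weight[OF assms(1)] assms(2) by auto
  \<comment> \<open>Equality is excluded as 4 does not divide \<open>n\<close>, and both sides of
    \<open>bound\<close> are even, so they differ by at least 2.\<close>
  have "int n + 2 \<le> 2 * gamma_sdR G" if "n mod 4 = 2"
    using that bound eq by presburger
  with bound show ?thesis
    by (auto simp: field_simps)
qed

end
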